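(* Let $\boldsymbol\rho\in\mathbb R_+^J$ with $\sum_{j=1}^J\rho_j=1$, and let $\mathcal V\subseteq\mathbb R_+^J$ be a $\boldsymbol\rho$-scaled invariant set. Let $\underline v=\min_{\boldsymbol v\in\mathcal V}\sum_{j}v_j$ and $\overline v=\max_{\boldsymbol v\in\mathcal V}\sum_j v_j$, with $0<\underline v\le\overline v<\infty$, and assume that for every $\xi\in[\underline v,\overline v]$ there exists $\boldsymbol v\in\mathcal V$ with $\sum_j v_j=\xi$. Then the randomized grand bundling mechanism $$[\boldsymbol q(\boldsymbol v)]_j=\frac{1+\ln\big(\sum_{i}v_i/\underline v\big)}{1+\ln(\overline v/\underline v)}\ \ (j\in\mathcal J),\qquad t(\boldsymbol v)=\frac{\sum_i v_i}{1+\ln(\overline v/\underline v)}$$ is robustly optimal, i.e. it belongs to $\mathcal M$ and is an optimal solution of $$\sup_{M\in\mathcal M}\ \inf_{\mathbb F\in\Delta(\mathcal V)}\frac{\mathrm{Rev}(M,\mathbb F)}{\sup_{M'\in\mathcal M}\mathrm{Rev}(M',\mathbb F)},$$ and it achieves the performance ratio $\frac{1}{1+\ln(\overline v/\underline v)}$. In addition, an optimal strategy for nature in the zero-sum game with payoff $\mathcal R(M,\mathbb F)$ (seller maximizing over $M\in\mathcal M$, nature minimizing over $\mathbb F\in\Delta(\mathcal V)$) is the law $\mathbb F^*$ of $\boldsymbol v(\xi)=(\xi\rho_1,\dots,\xi\rho_J)$, where $\xi\in[\underline v,\overline v]$ has cumulative distribution function $\mathbb G(\xi)=\frac{\ln\xi-\ln\underline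 v}{1+\ln(\overline v/\underline v)}$ for $\xi\in[\underline v,\overline v)$ and $\mathbb G(\overline v)=1$; that is, $\sup_{M\in\mathcal M}\mathcal R(M,\mathbb F^* )=\frac{1}{1+\ln(\overline v/\underline v)}$.
   Context: $\mathcal J=\{1,\dots,J\}$ is the set of products; $\boldsymbol 1$ is the all-ones vector. A set $\mathcal V\subseteq\mathbb R_+^J$ is $\boldsymbol\rho$-scaled invariant if for every $\boldsymbol v\in\mathcal V$ the vector $\big(\sum_{j}v_j\big)\boldsymbol\rho$ also belongs to $\mathcal V$. $\Delta(\mathcal V)$ is the set of Borel probability distributions on $\mathcal V$. A mechanism $M=(\boldsymbol q,t)$ on $\mathcal V$ consists of $\boldsymbol q:\mathcal V\to[0,1]^J$ and a (Borel measurable) $t:\mathcal V\to\mathbb R_+$. $\mathcal M$ is the set of mechanisms satisfying, for all $\boldsymbol v,\boldsymbol v'\in\mathcal V$, incentive compatibility $\boldsymbol q(\boldsymbol v)^\top\boldsymbol v-t(\boldsymbol v)\ge\boldsymbol q(\boldsymbol v')^\top\boldsymbol v-t(\boldsymbol v')$ and individual rationality $\boldsymbol q(\boldsymbol v)^\top\boldsymbol v-t(\boldsymbol v)\ge0$. For $M=(\boldsymbol q,t)$, $\mathrm{Rev}(M,\mathbb F)=\int t\,d\mathbb F$ and $\mathcal R(M,\mathbb F)=\mathbb E_{\boldsymbol v\sim\mathbb F}[t(\boldsymbol v)/\boldsymbol 1^\top\boldsymbol v]$. The performance ratio achieved by $M$ is $\inf_{\mathbb F\in\Delta(\mathcal V)}\mathrm{Rev}(M,\mathbb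 F)/\sup_{M'\in\mathcal M}\mathrm{Rev}(M',\mathbb F)$. *)

theory Defs
  imports "HOL-Probability.Probability"
begin

definition total_value :: "real ^ 'j \<Rightarrow> real" where
  "total_value v = (\<Sum>j\<in>UNIV. v $ j)"

definition scaled_invariant :: "real ^ 'j \<Rightarrow> (real ^ 'j) set \<Rightarrow> bool" where
  "scaled_invariant \<rho> V \<longleftrightarrow> (\<forall>v\<in>V. total_value v *\<^sub>R \<rho> \<in> V)"

(* V itself need not be a Borel set: it carries the trace of the Borel sigma-algebra. *)
definition distributions :: "(real ^ 'j) set \<Rightarrow> (real ^ 'j) measure set" where
  "distributions V = {F. prob_space F \<and> sets F = sets (restrict_space borel V)}"

(* A pair (q, t). Only the values on V matter. *)
type_synonym 'j mechanism = "(real ^ 'j \<Rightarrow> real ^ 'j) \<times> (real ^ 'j \<Rightarrow> real)"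

definition is_mechanism :: "(real ^ 'j) set \<Rightarrow> ('j::finite) mechanism \<Rightarrow> bool" where
  "is_mechanism V = (\<lambda>(q, t).
     (\<forall>v\<in>V. \<forall>j. q v $ j \<in> {0..1}) \<and>
     (\<forall>v\<in>V. 0 \<le> t v) \<and>
     t \<in> borel_measurable (restrict_space borel V))"

definition incentive_compatible :: "(real ^ 'j) set \<Rightarrow> ('j::finite) mechanism \<Rightarrow> bool" where
  "incentive_compatible V = (\<lambda>(q, t). \<forall>v\<in>V. \<forall>v'\<in>V. q v \<bullet> v - t v \<ge> q v' \<bullet> v - t v')"

definition individually_rational :: "(real ^ 'j) set \<Rightarrow> ('j::finite) mechanism \<Rightarrow> bool" where
  "individually_rational V = (\<lambda>(q, t). \<forall>v\<in>V. q v \<bullet> v - t v \<ge> 0)"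

definition mechanisms :: "(real ^ 'j) set \<Rightarrow> ('j::finite) mechanism set" where
  "mechanisms V = {M. is_mechanism V M \<and> incentive_compatible V M \<and> individually_rational V M}"

definition revenue :: "('j::finite) mechanism \<Rightarrow> (real ^ 'j) measure \<Rightarrow> real" where
  "revenue M F = (\<integral>v. snd M v \<partial>F)"

definition relative_revenue :: "('j::finite) mechanism \<Rightarrow> (real ^ 'j) measure \<Rightarrow> real" where
  "relative_revenue M F = (\<integral>v. snd M v / total_value v \<partial>F)"

(* Suprema and infima are taken in the complete lattice ereal, so that they need no
   boundedness side conditions. *)
definition performance_ratio :: "(real ^ 'j) set \<Rightarrow> ('j::finite) mechanism \<Rightarrow> ereal" where
  "performance_ratio V M =
     (INF F\<in>distributions V. ereal (revenue M F) / (SUP M'\<in>mechanisms V. ereal (revenue M' F)))"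

definition grand_bundling :: "real \<Rightarrow> real \<Rightarrow> ('j::finite) mechanism" where
  "grand_bundling vl vh =
     ((\<lambda>v. \<chi> j. (1 + ln (total_value v / vl)) / (1 + ln (vh / vl))),
      (\<lambda>v. total_value v / (1 + ln (vh / vl))))"

definition scale_cdf :: "real \<Rightarrow> real \<Rightarrow> real \<Rightarrow> real" where
  "scale_cdf vl vh \<xi> =
     (if \<xi> < vl then 0
      else if \<xi> < vh then (ln \<xi> - ln vl) / (1 + ln (vh / vl))
      else 1)"

definition scale_law :: "real \<Rightarrow> real \<Rightarrow> real measure" where
  "scale_law vl vh = interval_measure (scale_cdf vl vh)"

(* The law is concentrated on {vl..vh}; restricting to this interval is what makes
   the map into V well-defined and measurable. *)
definition nature_law :: "(real ^ 'j) set \<Rightarrow> real ^ 'j \<Rightarrow> real \<Rightarrow> real \<Rightarrow> (real ^ 'j) measure" where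
  "nature_law V \<rho> vl vh =
     distr (restrict_space (scale_law vl vh) {vl..vh}) (restrict_space borel V) (\<lambda>\<xi>. \<xi> *\<^sub>R \<rho>)"

lemma scale_cdf_mono:
  assumes "0 < vl" "vl \<le> vh" "x \<le> y"
  shows "scale_cdf vl vh x \<le> scale_cdf vl vh y"
proof -
  define c where "c = 1 + ln (vh / vl)"
  have c: "c > 0"
    using assms by (simp add: c_def add_pos_nonneg)
  have le1: "(ln z - ln vl) / c \<le> 1" if "vl \<le> z" "z < vh" for z
  proof -
    have "ln z \<le> ln vh"
      using that assms by simp
    moreover have "c = 1 + (ln vh - ln vl)"
      using assms by (simp add: c_def ln_div)
    ultimately have "ln z - ln vl \<le> c"
      by linarith
    then show ?thesis
      using c by simp
  qed
  have ge0: "0 \<le> (ln z - ln vl) / c" if "vl \<le> z" for z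
    using that assms c by simp
  have mono: "(ln x - ln vl) / c \<le> (ln y - ln vl) / c" if "vl \<le> x"
    using that assms c by (simp add: divide_right_mono)
  show ?thesis
    using assms le1[of x] ge0[of y] mono unfolding scale_cdf_def c_def[symmetric] by auto
qed

lemma scale_cdf_right_continuous:
  assumes "0 < vl" "vl \<le> vh"
  shows "continuous (at_right a) (scale_cdf vl vh)"
proof -
  consider "a < vl" | "vl \<le> a" "a < vh" | "vh \<le> a"
    by linarith
  then show ?thesis
  proof cases
    case 1
    have "eventually (\<lambda>x. scale_cdf vl vh x = 0) (at_right a)"
      using eventually_at_right_less[of a] eventually_at_right_real[OF 1]
      by eventually_elim (auto simp: scale_cdf_def)
    then show ?thesis
      using 1 by (simp add: continuous_within scale_cdf_def tendsto_eventually)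
  next
    case 2
    have "eventually (\<lambda>x. scale_cdf vl vh x = (ln x - ln vl) / (1 + ln (vh / vl))) (at_right a)"
      using eventually_at_right_real[OF 2(2)]
      by eventually_elim (use 2 in \<open>auto simp: scale_cdf_def\<close>)
    moreover have "((\<lambda>x. (ln x - ln vl) / (1 + ln (vh / vl))) \<longlongrightarrow>
        (ln a - ln vl) / (1 + ln (vh / vl))) (at_right a)"
    proof -
      have "1 + ln (vh / vl) > 0"
        using assms by (simp add: add_pos_nonneg)
      then show ?thesis
        using 2 assms by (intro tendsto_intros) auto
    qed
    moreover have "scale_cdf vl vh a = (ln a - ln vl) / (1 + ln (vh / vl))"
      using 2 by (auto simp: scale_cdf_def)
    ultimately show ?thesis
      by (simp add: continuous_within tendsto_cong)
  next
    case 3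
    have "eventually (\<lambda>x. scale_cdf vl vh x = 1) (at_right a)"
      using eventually_at_right_less[of a]
      by eventually_elim (use 3 assms in \<open>auto simp: scale_cdf_def\<close>)
    then show ?thesis
      using 3 assms by (simp add: continuous_within scale_cdf_def tendsto_eventually)
  qed
qed

lemma
  assumes "0 < vl" "vl \<le> vh"
  shows cdf_scale_law: "cdf (scale_law vl vh) = scale_cdf vl vh"
    and real_distribution_scale_law: "real_distribution (scale_law vl vh)"
proof -
  have bot: "(scale_cdf vl vh \<longlongrightarrow> 0) at_bot"
    by (intro tendsto_eventually) (auto simp: scale_cdf_def eventually_at_bot_dense)
  have top: "(scale_cdf vl vh \<longlongrightarrow> 1) at_top"
    using assms by (intro tendsto_eventually)
      (auto simp: scale_cdf_def eventually_at_top_linorder intro!: exI[of _ vh])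
  show "cdf (scale_law vl vh) = scale_cdf vl vh"
    unfolding scale_law_def
    by (intro cdf_interval_measure scale_cdf_mono scale_cdf_right_continuous bot assms)
  show "real_distribution (scale_law vl vh)"
    unfolding scale_law_def
    by (intro real_distribution_interval_measure scale_cdf_mono scale_cdf_right_continuous
        bot top assms)
qed

end

theory Submission
  imports Defs
begin

text \<open>
  Write \<open>c = 1 + ln (vh / vl)\<close>. Grand bundling always collects the fraction \<open>1 / c\<close> of the total
  value, and individual rationality caps the revenue of any mechanism by the total value, so grand
  bundling guarantees the ratio \<open>1 / c\<close>. Conversely, under a point mass at \<open>\<xi> *\<^sub>R \<rho>\<close> a posted price
  extracts everything, so the ratio of a mechanism is at most \<open>t (\<xi> *\<^sub>R \<rho>) / \<xi>\<close> for each \<open>\<xi>\<close>, hence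
  at most the average of this quantity under nature's law. On the ray spanned by \<open>\<rho>\<close> put
  \<open>h \<xi> = q (\<xi> *\<^sub>R \<rho>) \<bullet> \<rho>\<close> and \<open>\<Phi> \<xi> = h \<xi> - t (\<xi> *\<^sub>R \<rho>) / \<xi>\<close>, the buyer's utility per unit of value.
  Incentive compatibility gives \<open>d\<Phi> = t / \<xi>\<^sup>2 d\<xi>\<close>, so that average equals
  \<open>(\<Phi> vh - \<Phi> vl + t (vh *\<^sub>R \<rho>) / vh) / c = (h vh - \<Phi> vl) / c \<le> 1 / c\<close>. Only finite differences over
  a geometric partition are needed, with the ratio of the partition tending to 1.
\<close>

section \<open>Incentive compatibility in one dimension\<close>

context
  fixes h t :: "real \<Rightarrow> real" and vl vh :: real
  assumes vl_pos: "0 < vl"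
    and IC: "\<And>x y. x \<in> {vl..vh} \<Longrightarrow> y \<in> {vl..vh} \<Longrightarrow> h y * x - t y \<le> h x * x - t x"
begin

text \<open>Adding the two incentive constraints makes \<open>h\<close> nondecreasing. If the higher
  report were cheaper, type \<open>x\<close> would then get more for less by reporting
  \<open>y\<close>.\<close>

lemma IC_payment_mono:
  assumes "x \<in> {vl..vh}" "y \<in> {vl..vh}" "x \<le> y"
  shows "t x \<le> t y"
proof (cases "x = y")
  case False
  have "0 \<le> (h y - h x) * (y - x)"
    using IC[OF assms(1,2)] IC[OF assms(2,1)] by (simp add: algebra_simps)
  then have "h x \<le> h y"
    using False assms(3) by (simp add: zero_le_mult_iff)
  then have "h x * x \<le> h y * x"
    using assms(1) vl_pos by (intro mult_right_mono) auto
  then show ?thesis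
    using IC[OF assms(1,2)] by linarith
qed simp

text \<open>By reporting \<open>x\<close>, type \<open>y\<close> secures
  \<open>h x - t x / y\<close> per unit of its value; truth-telling must yield at least that. The
  factor \<open>1 / x - 1 / y\<close> is the integral of \<open>1 / \<xi>\<^sup>2\<close> from
  \<open>x\<close> to \<open>y\<close>, so this is the one-sided finite form of the differential
  relation for \<open>\<Phi>\<close>.\<close>

lemma IC_relative_utility_increment:
  assumes "x \<in> {vl..vh}" "y \<in> {vl..vh}"
  shows "t x * (1 / x - 1 / y) \<le> (h y - t y / y) - (h x - t x / x)"
proof -
  have pos: "0 < x" "0 < y"
    using assms vl_pos by auto
  have "(h x * y - t x) / y \<le> (h y * y - t y) / y"
    using IC[OF assms(2,1)] pos by (intro divide_right_mono) auto
  then have "h x - t x / y \<le> h y - t y / y"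
    using pos by (simp add: diff_divide_distrib)
  then show ?thesis
    by (simp add: algebra_simps)
qed

text \<open>On the geometric grid from \<open>vl\<close> to \<open>vh\<close> with quotient
  \<open>r\<close>, the integrand is dominated by a step function whose integral telescopes in
  \<open>\<Phi>\<close>. One factor \<open>r\<close> is lost when \<open>1 / z\<close> is bounded by
  its value at the left end of a cell, a second when \<open>(r - 1) / x\<close> is compared with
  \<open>1 / x - 1 / (r * x)\<close>.\<close>

lemma scale_law_integral_le_ratio:
  fixes r :: real and m :: nat
  assumes lt: "vl < vh" and r: "1 < r" "vl * r ^ Suc m = vh"
    and IR: "\<And>x. x \<in> {vl..vh} \<Longrightarrow> t x \<le> h x * x"
    and t0: "\<And>x. x \<in> {vl..vh} \<Longrightarrow> 0 \<le> t x"
    and h1: "h vh \<le> 1"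
  shows "(\<integral>x. indicator {vl..vh} x *\<^sub>R (t x / x) \<partial>scale_law vl vh) \<le> r\<^sup>2 / (1 + ln (vh / vl))"
proof -
  let ?L = "scale_law vl vh"
  interpret L: real_distribution ?L
    using real_distribution_scale_law vl_pos lt by simp
  define c where "c = 1 + ln (vh / vl)"
  have c: "c > 0"
    using vl_pos lt by (simp add: c_def add_pos_nonneg)
  define x where "x i = vl * r ^ i" for i
  have x_Suc: "x (Suc i) = r * x i" for i
    by (simp add: x_def)
  have x_mono: "x i \<le> x j" if "i \<le> j" for i j
    using that r vl_pos by (simp add: x_def power_increasing)
  have x_less: "x i < x (Suc i)" for i
    using r vl_pos by (simp add: x_def)
  have x_end: "x 0 = vl" "x (Suc m) = vh"
    using r by (auto simp: x_def)
  have x_in: "x i \<in> {vl..vh}" if "i \<le> Suc m" for i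
    using x_mono[of 0 i] x_mono[OF that] x_end by auto
  have x_pos: "0 < x i" for i
    using vl_pos r by (simp add: x_def)
  define \<Phi> where "\<Phi> z = h z - t z / z" for z
  \<comment> \<open>On a cell the payment is bounded by its value at the right end and
    \<open>1 / z\<close> by \<open>1 / x i\<close>, which is \<open>r / x (Suc i)\<close>. The cells
    are half-open so that their masses are differences of the cdf; the first summand covers the
    point \<open>vl\<close>, which lies in no cell.\<close>
  define g where "g z = (t vl / vl) * indicator {..vl} z
      + (\<Sum>i<Suc m. (r * (t (x (Suc i)) / x (Suc i))) * indicator {x i<..x (Suc i)} z)" for z
  have coef0: "0 \<le> r * (t (x (Suc i)) / x (Suc i))" if "i < Suc m" for i
    using t0[OF x_in[of "Suc i"]] x_pos[of "Suc i"] that r by simp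
  have sum0: "0 \<le> (\<Sum>i<Suc m. (r * (t (x (Suc i)) / x (Suc i))) * indicator {x i<..x (Suc i)} z)" for z
    by (intro sum_nonneg mult_nonneg_nonneg[OF coef0]) auto
  have g0: "0 \<le> g z" for z
    unfolding g_def using t0[of vl] vl_pos lt by (intro add_nonneg_nonneg[OF _ sum0]) auto
  have find: "\<exists>i<k. x i < z \<and> z \<le> x (Suc i)" if "vl < z" "z \<le> x k" for z k
    using that
  proof (induction k)
    case (Suc k)
    then show ?case
      by (cases "z \<le> x k") (auto intro: less_SucI)
  qed (use x_end in simp)
  have le_g: "indicator {vl..vh} z *\<^sub>R (t z / z) \<le> g z" for z
  proof (cases "z \<in> {vl..vh}")
    case z: True
    show ?thesis
    proof (cases "z = vl")
      case True
      show ?thesis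
        using True z sum0[of z] unfolding g_def by (simp del: sum.lessThan_Suc)
    next
      case False
      then obtain i where i: "i < Suc m" "x i < z" "z \<le> x (Suc i)"
        using find[of z "Suc m"] z x_end by auto
      have "t z / z \<le> t (x (Suc i)) / x i"
        using IC_payment_mono[OF z x_in[of "Suc i"]] i t0[OF z] x_pos[of i]
        by (intro frac_le) auto
      also have "\<dots> = r * (t (x (Suc i)) / x (Suc i)) * indicator {x i<..x (Suc i)} z"
        using i r x_pos[of i] by (simp add: x_Suc)
      also have "\<dots> \<le> (\<Sum>i<Suc m. (r * (t (x (Suc i)) / x (Suc i))) * indicator {x i<..x (Suc i)} z)"
        using i by (intro member_le_sum mult_nonneg_nonneg[OF coef0]) auto
      also have "\<dots> \<le> g z"
        using z False unfolding g_def by (simp del: sum.lessThan_Suc)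
      finally show ?thesis
        using z by simp
    qed
  qed (use g0 in simp)
  have F: "cdf ?L = scale_cdf vl vh"
    using cdf_scale_law vl_pos lt by simp
  have int_g: "integrable ?L g"
    unfolding g_def by (intro Bochner_Integration.integrable_add Bochner_Integration.integrable_sum
        integrable_mult_right integrable_real_indicator) (auto simp: L.emeasure_eq_measure)
  have "(\<integral>z. g z \<partial>?L) = (t vl / vl) * measure ?L {..vl}
      + (\<Sum>i<Suc m. (r * (t (x (Suc i)) / x (Suc i))) * measure ?L {x i<..x (Suc i)})"
    unfolding g_def
    by (subst Bochner_Integration.integral_add)
      (auto simp: L.emeasure_eq_measure Bochner_Integration.integral_sum simp del: sum.lessThan_Suc
        intro!: Bochner_Integration.integrable_sum integrable_mult_right integrable_real_indicator)
  \<comment> \<open>This is where \<open>vl < vh\<close> enters: for equal endpoints the law is a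
    point mass at \<open>vl\<close>.\<close>
  also have "measure ?L {..vl} = 0"
    using F lt by (simp add: cdf_def scale_cdf_def fun_eq_iff)
  also have "(\<Sum>i<Suc m. (r * (t (x (Suc i)) / x (Suc i))) * measure ?L {x i<..x (Suc i)})
      = (\<Sum>i<Suc m. (r * (t (x (Suc i)) / x (Suc i))) * (scale_cdf vl vh (x (Suc i)) - scale_cdf vl vh (x i)))"
    using L.cdf_diff_eq[OF x_less] F by simp
  finally have int_eq: "(\<integral>z. g z \<partial>?L) =
      (\<Sum>i<Suc m. (r * (t (x (Suc i)) / x (Suc i))) * (scale_cdf vl vh (x (Suc i)) - scale_cdf vl vh (x i)))"
    by simp
  \<comment> \<open>The bound \<open>i \<le> m\<close> keeps \<open>x i\<close> below
    \<open>vh\<close>, where the cdf jumps by \<open>1 / c\<close>. Equal ratios give cells of equal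
    logarithmic length, hence of equal mass.\<close>
  have cdf_x: "scale_cdf vl vh (x i) = i * ln r / c" if "i \<le> m" for i
  proof -
    have "x i < vh"
      using x_less[of m] x_mono[OF that] x_end by simp
    moreover have "vl \<le> x i"
      using x_in[of i] that by simp
    ultimately have "scale_cdf vl vh (x i) = (ln (x i) - ln vl) / c"
      by (simp add: scale_cdf_def c_def)
    also have "ln (x i) = ln vl + i * ln r"
      using vl_pos r(1) unfolding x_def by (simp add: ln_mult ln_realpow)
    finally show ?thesis
      by simp
  qed
  have c_eq: "c = 1 + real (Suc m) * ln r"
    using vl_pos r(1) unfolding c_def r(2)[symmetric] by (simp add: ln_realpow ln_mult algebra_simps)
  have ln_r: "ln r \<le> r - 1"
    using r by (simp add: ln_le_minus_one)
  \<comment> \<open>The payment at the right end of cell \<open>i\<close> is charged to the utility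
    increment over the following cell. The last cell has no successor and is treated
    separately.\<close>
  have inner: "(r * (t (x (Suc i)) / x (Suc i))) * (scale_cdf vl vh (x (Suc i)) - scale_cdf vl vh (x i))
      \<le> r\<^sup>2 / c * (\<Phi> (x (Suc (Suc i))) - \<Phi> (x (Suc i)))" if "i < m" for i
  proof -
    have "scale_cdf vl vh (x (Suc i)) - scale_cdf vl vh (x i) = ln r / c"
      using that by (simp add: cdf_x distrib_right add_divide_distrib)
    also have "\<dots> \<le> (r - 1) / c"
      using ln_r c by (simp add: divide_right_mono)
    finally have "(r * (t (x (Suc i)) / x (Suc i))) * (scale_cdf vl vh (x (Suc i)) - scale_cdf vl vh (x i))
        \<le> (r * (t (x (Suc i)) / x (Suc i))) * ((r - 1) / c)"
      using coef0[of i] that by (intro mult_left_mono) auto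
    also have "\<dots> = r\<^sup>2 / c * (t (x (Suc i)) * (1 / x (Suc i) - 1 / x (Suc (Suc i))))"
      using x_pos[of i] r c by (simp add: x_Suc field_simps power2_eq_square)
    also have "\<dots> \<le> r\<^sup>2 / c * (\<Phi> (x (Suc (Suc i))) - \<Phi> (x (Suc i)))"
      unfolding \<Phi>_def using that c
      by (intro mult_left_mono IC_relative_utility_increment x_in) auto
    finally show ?thesis .
  qed
  \<comment> \<open>The last cell also carries the atom \<open>1 / c\<close> at \<open>vh\<close>,
    so its mass is \<open>(1 + ln r) / c\<close>, at most \<open>r / c\<close>.\<close>
  have last: "(r * (t vh / vh)) * (scale_cdf vl vh vh - scale_cdf vl vh (x m)) \<le> r\<^sup>2 / c * (t vh / vh)"
  proof -
    have "scale_cdf vl vh vh = c / c"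
      using c lt by (simp add: scale_cdf_def)
    then have "scale_cdf vl vh vh - scale_cdf vl vh (x m) = (c - m * ln r) / c"
      by (simp add: cdf_x diff_divide_distrib)
    also have "c - m * ln r = 1 + ln r"
      by (simp add: c_eq algebra_simps)
    also have "(1 + ln r) / c \<le> r / c"
      using ln_r c by (simp add: divide_right_mono)
    finally have "(r * (t vh / vh)) * (scale_cdf vl vh vh - scale_cdf vl vh (x m)) \<le> (r * (t vh / vh)) * (r / c)"
      using coef0[of m] x_end by (intro mult_left_mono) auto
    then show ?thesis
      by (simp add: power2_eq_square mult_ac)
  qed
  \<comment> \<open>Nothing is assumed about measurability of \<open>t\<close> here. The rule asks
    for integrability of \<open>g\<close> only; nonnegativity of \<open>g\<close> covers the default
    integral 0 of a non-integrable function on the left.\<close>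
  have "(\<integral>z. indicator {vl..vh} z *\<^sub>R (t z / z) \<partial>?L) \<le> (\<integral>z. g z \<partial>?L)"
    using le_g g0 int_g by (intro Bochner_Integration.integral_mono_AE') auto
  also have "\<dots> \<le> (\<Sum>i<m. r\<^sup>2 / c * (\<Phi> (x (Suc (Suc i))) - \<Phi> (x (Suc i)))) + r\<^sup>2 / c * (t vh / vh)"
    unfolding int_eq sum.lessThan_Suc x_end by (intro add_mono sum_mono inner last) auto
  also have "\<dots> = r\<^sup>2 / c * (\<Phi> vh - \<Phi> (x 1) + t vh / vh)"
    unfolding sum_distrib_left[symmetric]
    using sum_lessThan_telescope[of "\<lambda>i. \<Phi> (x (Suc i))" m] x_end by (simp add: distrib_left)
  \<comment> \<open>The terms at \<open>vh\<close> combine to \<open>h vh\<close>, at most 1, and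
    \<open>\<Phi> (x 1)\<close> is nonnegative by individual rationality.\<close>
  also have "\<dots> \<le> r\<^sup>2 / c * 1"
  proof -
    have "0 \<le> \<Phi> (x 1)"
      using IR[OF x_in[of 1]] x_pos[of 1] by (simp add: \<Phi>_def field_simps)
    then show ?thesis
      using h1 c by (intro mult_left_mono) (auto simp: \<Phi>_def)
  qed
  finally show ?thesis
    by (simp add: c_def)
qed

text \<open>Refining the grid removes the factor \<open>r\<^sup>2\<close>. Equal endpoints admit no
  quotient above 1; there \<open>c\<close> is 1 and individual rationality alone bounds the
  integrand by 1.\<close>

lemma scale_law_integral_le:
  assumes le: "vl \<le> vh"
    and IR: "\<And>x. x \<in> {vl..vh} \<Longrightarrow> t x \<le> h x * x"
    and t0: "\<And>x. x \<in> {vl..vh} \<Longrightarrow> 0 \<le> t x"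
    and h1: "h vh \<le> 1"
  shows "(\<integral>x. indicator {vl..vh} x *\<^sub>R (t x / x) \<partial>scale_law vl vh) \<le> 1 / (1 + ln (vh / vl))"
proof (cases "vl = vh")
  case True
  interpret L: real_distribution "scale_law vl vh"
    using real_distribution_scale_law vl_pos le by simp
  have "h vh * vh \<le> 1 * vh"
    using h1 True vl_pos by (intro mult_right_mono) auto
  then have "t vh \<le> vh"
    using IR[of vh] True by auto
  then have "(\<integral>x. indicator {vl..vh} x *\<^sub>R (t x / x) \<partial>scale_law vl vh) \<le> (\<integral>x. 1 \<partial>scale_law vl vh)"
    using True vl_pos
    by (intro Bochner_Integration.integral_mono_AE' L.integrable_const) (auto simp: indicator_def)
  then show ?thesis
    using True vl_pos L.prob_space by simp
next
  case False
  then have lt: "vl < vh"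
    using le by simp
  \<comment> \<open>The \<open>Suc m\<close>-th root makes a grid of \<open>Suc m\<close> cells end
    exactly at \<open>vh\<close>, and it tends to 1 as \<open>m\<close> grows.\<close>
  define r where "r m = (vh / vl) powr (1 / real (Suc m))" for m
  have k: "1 < vh / vl"
    using lt vl_pos by simp
  have "r m ^ Suc m = vh / vl" for m
    using k vl_pos lt unfolding r_def by (subst powr_power) auto
  then have r_pow: "vl * r m ^ Suc m = vh" for m
    using vl_pos by (simp del: power_Suc)
  have r1: "1 < r m" for m
    using k unfolding r_def by (intro gr_one_powr) auto
  have "r \<longlonglongrightarrow> (vh / vl) powr 0"
    unfolding r_def
    using k LIMSEQ_inverse_real_of_nat by (intro tendsto_powr tendsto_const) (auto simp: inverse_eq_divide)
  then have "r \<longlonglongrightarrow> 1"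
    using vl_pos lt by simp
  then have lim: "(\<lambda>m. (r m)\<^sup>2 / (1 + ln (vh / vl))) \<longlonglongrightarrow> 1\<^sup>2 / (1 + ln (vh / vl))"
    using k by (intro tendsto_intros) (auto simp: add_pos_nonneg less_imp_neq[symmetric])
  have "(\<integral>x. indicator {vl..vh} x *\<^sub>R (t x / x) \<partial>scale_law vl vh) \<le> 1\<^sup>2 / (1 + ln (vh / vl))"
    by (rule LIMSEQ_le_const[OF lim])
      (use scale_law_integral_le_ratio[OF lt r1 r_pow IR t0 h1] in auto)
  then show ?thesis
    by simp
qed

end

section \<open>The interval carrying the scale law\<close>

lemma measure_scale_law_Icc:
  assumes "0 < vl" "vl \<le> vh"
  shows "measure (scale_law vl vh) {vl..vh} = 1"
proof -
  interpret L: real_distribution "scale_law vl vh"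
    using real_distribution_scale_law assms by simp
  have F: "cdf (scale_law vl vh) = scale_cdf vl vh"
    using cdf_scale_law assms by simp
  \<comment> \<open>The left limit at \<open>vl\<close> excludes mass below \<open>vl\<close> even
    when \<open>vl = vh\<close>, where the value of the cdf at \<open>vl\<close> is already
    1.\<close>
  have "(scale_cdf vl vh \<longlongrightarrow> 0) (at_left vl)"
    by (intro tendsto_eventually) (auto simp: eventually_at_filter scale_cdf_def)
  then have low: "measure (scale_law vl vh) {..<vl} = 0"
    using L.cdf_at_left[of vl] unfolding F
    by (metis tendsto_unique trivial_limit_at_left_real)
  have high: "measure (scale_law vl vh) {..vh} = 1"
    using F assms by (simp add: cdf_def scale_cdf_def fun_eq_iff)
  have Icc: "{vl..vh} = {..vh} - {..<vl}"
    by auto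
  have "measure (scale_law vl vh) {vl..vh}
      = measure (scale_law vl vh) {..vh} - measure (scale_law vl vh) {..<vl}"
    unfolding Icc using assms by (intro L.finite_measure_Diff) auto
  then show ?thesis
    by (simp only: low high diff_zero)
qed

section \<open>Mechanisms\<close>

lemma total_value_scaleR: "total_value (a *\<^sub>R v) = a * total_value v"
  by (simp add: total_value_def sum_distrib_left)

lemma inner_const_vec: "(\<chi> j. a) \<bullet> v = a * total_value (v :: real ^ 'j)"
  by (simp add: inner_vec_def total_value_def sum_distrib_left)

lemma measurable_total_value [measurable]: "total_value \<in> borel_measurable (restrict_space borel V)"
  unfolding total_value_def[abs_def]
  by (intro measurable_restrict_space1 borel_measurable_continuous_onI continuous_intros)

text \<open>Scaled invariance and the attainability of every total are condensed into
  \<open>ray\<close>: the whole segment on which nature's law lives belongs to \<open>V\<close>. The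
  extreme totals enter as bounds.\<close>

locale robust_bundling =
  fixes \<rho> :: "real ^ 'j" and V :: "(real ^ 'j) set" and vl vh :: real
  assumes rho_sum: "total_value \<rho> = 1"
    and V_nonneg: "\<And>v j. v \<in> V \<Longrightarrow> 0 \<le> v $ j"
    and ray: "\<And>\<xi>. \<xi> \<in> {vl..vh} \<Longrightarrow> \<xi> *\<^sub>R \<rho> \<in> V"
    and rho_nonneg: "\<And>j. 0 \<le> \<rho> $ j"
    and total_value_bounds: "\<And>v. v \<in> V \<Longrightarrow> total_value v \<in> {vl..vh}"
    and vl_pos: "0 < vl" and vl_le_vh: "vl \<le> vh"
begin

abbreviation c :: real where "c \<equiv> 1 + ln (vh / vl)"

lemma c_pos: "0 < c"
  using vl_pos vl_le_vh by (simp add: add_pos_nonneg)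

lemma total_value_pos: "v \<in> V \<Longrightarrow> 0 < total_value v"
  using total_value_bounds[of v] vl_pos by simp

text \<open>Reporting total \<open>s'\<close> with true total \<open>s\<close> yields
  \<open>((1 + ln (s' / vl)) * s - s') / c\<close>. The inequality \<open>ln x \<le> x - 1\<close>
  at \<open>x = s' / s\<close> shows that this is largest at \<open>s' = s\<close>, where it equals
  \<open>s * ln (s / vl) / c\<close>, which is nonnegative.\<close>

lemma grand_bundling_in_mechanisms: "grand_bundling vl vh \<in> mechanisms V"
proof -
  have "(1 + ln (total_value v / vl)) / c \<in> {0..1}" if "v \<in> V" for v
    using total_value_bounds[OF that] vl_pos vl_le_vh c_pos
    by (auto intro!: divide_nonneg_pos add_nonneg_nonneg divide_right_mono)
  moreover have "(\<lambda>v. total_value v / c) \<in> borel_measurable (restrict_space borel V)"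
    by measurable
  ultimately have "is_mechanism V (grand_bundling vl vh)"
    using total_value_pos c_pos
    by (auto simp: is_mechanism_def grand_bundling_def less_imp_le intro!: divide_nonneg_pos)
  moreover have "incentive_compatible V (grand_bundling vl vh)"
    unfolding incentive_compatible_def grand_bundling_def prod.case inner_const_vec
  proof (intro ballI)
    fix v v' assume v: "v \<in> V" "v' \<in> V"
    let ?s = "total_value v" and ?s' = "total_value v'"
    have pos: "0 < ?s" "0 < ?s'"
      using v total_value_pos by auto
    have "ln (?s' / ?s) \<le> ?s' / ?s - 1"
      using pos by (intro ln_le_minus_one) auto
    then have "?s * ln (?s' / ?s) \<le> ?s' - ?s"
      using pos by (simp add: field_simps)
    then have "(1 + ln (?s' / vl)) * ?s - ?s' \<le> (1 + ln (?s / vl)) * ?s - ?s"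
      using pos vl_pos by (simp add: ln_div algebra_simps)
    then have "((1 + ln (?s' / vl)) * ?s - ?s') / c \<le> ((1 + ln (?s / vl)) * ?s - ?s) / c"
      using c_pos by (intro divide_right_mono) auto
    then show "(1 + ln (?s' / vl)) / c * ?s - ?s' / c \<le> (1 + ln (?s / vl)) / c * ?s - ?s / c"
      by (simp add: diff_divide_distrib)
  qed
  moreover have "individually_rational V (grand_bundling vl vh)"
    unfolding individually_rational_def grand_bundling_def prod.case inner_const_vec
  proof
    fix v assume v: "v \<in> V"
    have "0 \<le> ln (total_value v / vl) * total_value v / c"
      using total_value_bounds[OF v] vl_pos c_pos by simp
    then show "0 \<le> (1 + ln (total_value v / vl)) / c * total_value v - total_value v / c"
      by (simp add: distrib_right add_divide_distrib)
  qed
  ultimately show ?thesis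
    by (simp add: mechanisms_def)
qed

lemma mechanism_payment:
  assumes "M \<in> mechanisms V"
  shows "snd M \<in> borel_measurable (restrict_space borel V)"
    and "v \<in> V \<Longrightarrow> 0 \<le> snd M v" and "v \<in> V \<Longrightarrow> snd M v \<le> total_value v"
proof -
  obtain q t where M: "M = (q, t)"
    by (cases M)
  show "snd M \<in> borel_measurable (restrict_space borel V)" "v \<in> V \<Longrightarrow> 0 \<le> snd M v"
    using assms by (auto simp: M mechanisms_def is_mechanism_def)
  assume v: "v \<in> V"
  have "q v \<bullet> v \<le> total_value v"
    unfolding inner_vec_def total_value_def using assms v V_nonneg[OF v]
    by (intro sum_mono) (auto simp: M mechanisms_def is_mechanism_def intro!: mult_left_le_one_le)
  then show "snd M v \<le> total_value v"
    using assms v by (fastforce simp: M mechanisms_def individually_rational_def)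
qed

text \<open>The benchmark against a known type: a price equal to its total value is still accepted,
  since ties are resolved in favour of a sale, and extracts the whole surplus.\<close>

definition posted_price :: "real \<Rightarrow> 'j mechanism" where
  "posted_price p =
     ((\<lambda>v. \<chi> j. if p \<le> total_value v then 1 else 0), (\<lambda>v. if p \<le> total_value v then p else 0))"

lemma posted_price_in_mechanisms:
  assumes "0 \<le> p"
  shows "posted_price p \<in> mechanisms V"
proof -
  have "(\<lambda>v. if p \<le> total_value v then p else 0) \<in> borel_measurable (restrict_space borel V)"
    by measurable
  then show ?thesis
    using assms by (auto simp: posted_price_def mechanisms_def is_mechanism_def
        incentive_compatible_def individually_rational_def inner_const_vec)
qed

section \<open>Distributions\<close>

lemma distributionsD:
  assumes "F \<in> distributions V"
  shows "prob_space F" "sets F = sets (restrict_space borel V)" "space F = V"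
  using assms sets_eq_imp_space_eq[of F "restrict_space borel V"]
  by (auto simp: distributions_def space_restrict_space)

lemma bounded_integrable:
  fixes f :: "real ^ 'j \<Rightarrow> real"
  assumes "F \<in> distributions V" "f \<in> borel_measurable (restrict_space borel V)"
    and "\<And>v. v \<in> V \<Longrightarrow> 0 \<le> f v" "\<And>v. v \<in> V \<Longrightarrow> f v \<le> b"
  shows "integrable F f"
proof -
  note F = distributionsD[OF assms(1)]
  interpret prob_space F by (rule F)
  have "f \<in> borel_measurable F"
    using assms(2) measurable_cong_sets[OF F(2) refl] by blast
  then show ?thesis
    using assms(3,4) F(3) by (intro integrable_const_bound[where B = b]) auto
qed

lemma relative_revenue_grand_bundling:
  assumes "F \<in> distributions V"
  shows "relative_revenue (grand_bundling vl vh) F = 1 / c"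
proof -
  note F = distributionsD[OF assms]
  interpret prob_space F by (rule F)
  have "relative_revenue (grand_bundling vl vh) F = (\<integral>v. 1 / c \<partial>F)"
    unfolding relative_revenue_def grand_bundling_def using F(3) total_value_pos
    by (intro Bochner_Integration.integral_cong) (auto simp: less_imp_neq[symmetric])
  then show ?thesis
    using prob_space by simp
qed

section \<open>Revenue compared with the full surplus\<close>

lemma integrable_total_value:
  assumes "F \<in> distributions V"
  shows "integrable F total_value"
  using total_value_bounds less_imp_le[OF total_value_pos]
  by (intro bounded_integrable[OF assms, where b = vh] measurable_total_value) auto

lemma integrable_payment:
  assumes F: "F \<in> distributions V" and M: "M \<in> mechanisms V"
  shows "integrable F (snd M)"
proof (rule bounded_integrable[OF F mechanism_payment(1,2)[OF M]])
  show "snd M v \<le> vh" if "v \<in> V" for v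
    using mechanism_payment(3)[OF M that] total_value_bounds[OF that] by simp
qed

lemma revenue_le_total:
  assumes "F \<in> distributions V" "M \<in> mechanisms V"
  shows "revenue M F \<le> (\<integral>v. total_value v \<partial>F)"
  unfolding revenue_def
  using distributionsD(3)[OF assms(1)] mechanism_payment(3)[OF assms(2)]
  by (intro integral_mono integrable_payment integrable_total_value assms) auto

lemma performance_ratio_grand_bundling_ge:
  "ereal (1 / c) \<le> performance_ratio V (grand_bundling vl vh)"
  unfolding performance_ratio_def
proof (rule INF_greatest)
  fix F assume F: "F \<in> distributions V"
  interpret prob_space F by (rule distributionsD[OF F])
  let ?S = "SUP M'\<in>mechanisms V. ereal (revenue M' F)"
  let ?T = "\<integral>v. total_value v \<partial>F"
  have "vl \<le> ?T"
    using total_value_bounds distributionsD(3)[OF F]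
    by (intro integral_ge_const integrable_total_value F) auto
  then have T: "0 < ?T"
    using vl_pos by simp
  have rev: "revenue (grand_bundling vl vh) F = ?T / c"
    by (simp add: revenue_def grand_bundling_def)
  have up: "?S \<le> ereal ?T"
    using revenue_le_total[OF F] by (intro SUP_least) auto
  have lo: "ereal (?T / c) \<le> ?S"
    using grand_bundling_in_mechanisms rev by (metis SUP_upper)
  \<comment> \<open>The optimal revenue lies between \<open>?T / c\<close> and \<open>?T\<close>, so
    it is real and positive, and the division in \<open>ereal\<close> becomes one of reals.\<close>
  obtain S where S: "?S = ereal S"
    using up lo by (cases ?S) auto
  have "0 < ?T / c"
    using T c_pos by simp
  then have "0 < S" "S \<le> ?T"
    using up lo S by auto
  then have "1 / c \<le> (?T / S) / c"
    using c_pos by (intro divide_right_mono) auto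
  then have "1 / c \<le> (?T / c) / S"
    by (simp only: divide_divide_eq_left mult.commute)
  then show "ereal (1 / c) \<le> ereal (revenue (grand_bundling vl vh) F) / ?S"
    using \<open>0 < S\<close> unfolding S rev by simp
qed

text \<open>The point mass at \<open>v\<close> is one choice of nature. Under it no mechanism earns
  more than the total value of \<open>v\<close>, and the posted price at that level attains it, so
  the denominator is exactly \<open>total_value v\<close>.\<close>

lemma performance_ratio_le_point:
  assumes M: "M \<in> mechanisms V" and v: "v \<in> V"
  shows "performance_ratio V M \<le> ereal (snd M v / total_value v)"
proof -
  let ?F = "return (restrict_space borel V) v"
  have sp: "v \<in> space (restrict_space borel V)"
    using v by (simp add: space_restrict_space)
  have F: "?F \<in> distributions V"
    using prob_space_return[OF sp] by (simp add: distributions_def)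
  have rev: "revenue M' ?F = snd M' v" if "M' \<in> mechanisms V" for M'
    unfolding revenue_def using mechanism_payment(1)[OF that] sp by (simp add: integral_return)
  have "(SUP M'\<in>mechanisms V. ereal (revenue M' ?F)) = ereal (total_value v)"
  proof (rule antisym)
    show "(SUP M'\<in>mechanisms V. ereal (revenue M' ?F)) \<le> ereal (total_value v)"
      using mechanism_payment(3) rev v by (intro SUP_least) auto
    have P: "posted_price (total_value v) \<in> mechanisms V"
      using total_value_pos[OF v] by (intro posted_price_in_mechanisms) simp
    show "ereal (total_value v) \<le> (SUP M'\<in>mechanisms V. ereal (revenue M' ?F))"
      by (rule SUP_upper2[OF P]) (simp add: rev[OF P], simp add: posted_price_def)
  qed
  then show ?thesis
    unfolding performance_ratio_def using total_value_pos[OF v]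
    by (intro INF_lower2[OF F]) (simp add: rev[OF M])
qed

section \<open>Nature's law on the ray\<close>

lemma measurable_ray:
  "(\<lambda>\<xi>. \<xi> *\<^sub>R \<rho>) \<in> measurable (restrict_space (scale_law vl vh) {vl..vh}) (restrict_space borel V)"
proof -
  interpret L: real_distribution "scale_law vl vh"
    using real_distribution_scale_law vl_pos vl_le_vh by simp
  show ?thesis
    using ray by (intro measurable_restrict_space2 measurable_restrict_space1)
      (auto simp: space_restrict_space)
qed

lemma nature_law_in_distributions: "nature_law V \<rho> vl vh \<in> distributions V"
proof -
  interpret L: real_distribution "scale_law vl vh"
    using real_distribution_scale_law vl_pos vl_le_vh by simp
  have "prob_space (restrict_space (scale_law vl vh) {vl..vh})"
    using measure_scale_law_Icc[OF vl_pos vl_le_vh]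
    by (intro prob_spaceI) (simp add: emeasure_restrict_space space_restrict_space L.emeasure_eq_measure)
  then show ?thesis
    unfolding distributions_def nature_law_def
    using measurable_ray by (auto intro: prob_space.prob_space_distr)
qed

text \<open>On the ray the buyer has the single parameter \<open>\<xi>\<close>: the value of an
  allocation is \<open>\<xi>\<close> times its inner product with \<open>\<rho>\<close>, and the
  total value is \<open>\<xi>\<close>. The constraints of \<open>M\<close> thus restrict to the
  one-dimensional ones, with \<open>h\<close> at most 1 at \<open>vh\<close> because the entries of
  \<open>\<rho>\<close> are nonnegative with sum 1.\<close>

lemma relative_revenue_nature_law_le:
  assumes M: "M \<in> mechanisms V"
  shows "relative_revenue M (nature_law V \<rho> vl vh) \<le> 1 / c"
proof -
  interpret L: real_distribution "scale_law vl vh"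
    using real_distribution_scale_law vl_pos vl_le_vh by simp
  obtain q t where M_eq: "M = (q, t)"
    by (cases M)
  define h where "h \<xi> = q (\<xi> *\<^sub>R \<rho>) \<bullet> \<rho>" for \<xi>
  have [measurable]: "t \<in> borel_measurable (restrict_space borel V)"
    using mechanism_payment(1)[OF M] by (simp add: M_eq)
  have "relative_revenue M (nature_law V \<rho> vl vh)
      = (\<integral>\<xi>. t (\<xi> *\<^sub>R \<rho>) / \<xi> \<partial>restrict_space (scale_law vl vh) {vl..vh})"
    unfolding relative_revenue_def nature_law_def M_eq snd_conv
    by (subst integral_distr[OF measurable_ray]) (simp_all add: total_value_scaleR rho_sum)
  also have "\<dots> = (\<integral>\<xi>. indicator {vl..vh} \<xi> *\<^sub>R (t (\<xi> *\<^sub>R \<rho>) / \<xi>) \<partial>scale_law vl vh)"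
    by (subst integral_restrict_space) auto
  also have "\<dots> \<le> 1 / c"
  proof (rule scale_law_integral_le[where h = h, OF vl_pos _ vl_le_vh])
    fix x y assume x: "x \<in> {vl..vh}" and y: "y \<in> {vl..vh}"
    show "h y * x - t (y *\<^sub>R \<rho>) \<le> h x * x - t (x *\<^sub>R \<rho>)"
      using M ray[OF x] ray[OF y]
      by (fastforce simp: M_eq h_def mechanisms_def incentive_compatible_def mult.commute)
  next
    fix x assume x: "x \<in> {vl..vh}"
    show "t (x *\<^sub>R \<rho>) \<le> h x * x"
      using M ray[OF x]
      by (fastforce simp: M_eq h_def mechanisms_def individually_rational_def mult.commute)
    show "0 \<le> t (x *\<^sub>R \<rho>)"
      using mechanism_payment(2)[OF M ray[OF x]] by (simp add: M_eq)
  next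
    have "vh *\<^sub>R \<rho> \<in> V"
      using vl_le_vh by (intro ray) auto
    then have "h vh \<le> total_value \<rho>"
      unfolding h_def inner_vec_def total_value_def using M rho_nonneg
      by (intro sum_mono) (auto simp: M_eq mechanisms_def is_mechanism_def intro!: mult_left_le_one_le)
    then show "h vh \<le> 1"
      by (simp add: rho_sum)
  qed
  finally show ?thesis .
qed

text \<open>A real \<open>d\<close> strictly between \<open>1 / c\<close> and the ratio would bound
  the relative payment from below at every point of \<open>V\<close>, by the point masses. Averaging
  over nature's law then contradicts the bound on relative revenue.\<close>

lemma performance_ratio_le:
  assumes M: "M \<in> mechanisms V"
  shows "performance_ratio V M \<le> ereal (1 / c)"
proof (rule ccontr)
  assume "\<not> ?thesis"
  then obtain d where d: "1 / c < d" "ereal d < performance_ratio V M"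
    by (metis ereal_dense2 less_ereal.simps(1) not_le)
  let ?F = "nature_law V \<rho> vl vh"
  interpret prob_space ?F by (rule distributionsD[OF nature_law_in_distributions])
  have lower: "d \<le> snd M v / total_value v" if "v \<in> V" for v
    using d(2) performance_ratio_le_point[OF M that] by (metis ereal_less_eq(3) less_le_trans less_imp_le)
  have [measurable]: "snd M \<in> borel_measurable (restrict_space borel V)"
    by (rule mechanism_payment(1)[OF M])
  have "integrable ?F (\<lambda>v. snd M v / total_value v)"
    using mechanism_payment(2,3)[OF M] total_value_pos
    by (intro bounded_integrable[OF nature_law_in_distributions, where b = 1])
      (auto simp: less_imp_le)
  then have "d \<le> relative_revenue M ?F"
    unfolding relative_revenue_def
    using lower distributionsD(3)[OF nature_law_in_distributions] by (intro integral_ge_const) auto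
  then show False
    using relative_revenue_nature_law_le[OF M] d(1) by simp
qed

section \<open>Optimality and the value of the game\<close>

lemma performance_ratio_grand_bundling:
  "performance_ratio V (grand_bundling vl vh) = ereal (1 / c)"
  using performance_ratio_le[OF grand_bundling_in_mechanisms] performance_ratio_grand_bundling_ge
  by (rule antisym)

lemma grand_bundling_optimal:
  "performance_ratio V (grand_bundling vl vh) = (SUP M\<in>mechanisms V. performance_ratio V M)"
  by (rule antisym, rule SUP_upper[OF grand_bundling_in_mechanisms], rule SUP_least)
    (simp add: performance_ratio_grand_bundling performance_ratio_le)

lemma SUP_relative_revenue_ge:
  assumes "F \<in> distributions V"
  shows "ereal (1 / c) \<le> (SUP M\<in>mechanisms V. ereal (relative_revenue M F))"
  by (rule SUP_upper2[OF grand_bundling_in_mechanisms])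
    (simp add: relative_revenue_grand_bundling[OF assms])

lemma SUP_relative_revenue_nature_law:
  "(SUP M\<in>mechanisms V. ereal (relative_revenue M (nature_law V \<rho> vl vh))) = ereal (1 / c)"
  using relative_revenue_nature_law_le
  by (intro antisym[OF SUP_least] SUP_relative_revenue_ge nature_law_in_distributions) simp

text \<open>Grand bundling secures \<open>1 / c\<close> against every distribution, and nature's law
  concedes no more, so the infimum is attained there.\<close>

lemma INF_SUP_relative_revenue:
  "(INF F\<in>distributions V. SUP M\<in>mechanisms V. ereal (relative_revenue M F)) = ereal (1 / c)"
proof (rule antisym)
  show "(INF F\<in>distributions V. SUP M\<in>mechanisms V. ereal (relative_revenue M F)) \<le> ereal (1 / c)"
    by (rule INF_lower2[OF nature_law_in_distributions]) (simp only: SUP_relative_revenue_nature_law order_refl)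
qed (intro INF_greatest SUP_relative_revenue_ge)

end

theorem theorem2:
  fixes \<rho> :: "real ^ 'j" and V :: "(real ^ 'j) set" and vl vh :: real
  assumes rho_nonneg: "\<And>j. 0 \<le> \<rho> $ j"
    and rho_sum: "(\<Sum>j\<in>UNIV. \<rho> $ j) = 1"
    and V_nonneg: "\<And>v j. v \<in> V \<Longrightarrow> 0 \<le> v $ j"
    and V_inv: "scaled_invariant \<rho> V"
    and vl_min: "vl \<in> total_value ` V" "\<And>v. v \<in> V \<Longrightarrow> vl \<le> total_value v"
    and vh_max: "vh \<in> total_value ` V" "\<And>v. v \<in> V \<Longrightarrow> total_value v \<le> vh"
    and vl_pos: "0 < vl"
    and all_totals: "\<And>\<xi>. \<xi> \<in> {vl..vh} \<Longrightarrow> \<exists>v\<in>V. total_value v = \<xi>"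
  shows "grand_bundling vl vh \<in> mechanisms V \<and>
         performance_ratio V (grand_bundling vl vh) = (SUP M\<in>mechanisms V. performance_ratio V M) \<and>
         performance_ratio V (grand_bundling vl vh) = ereal (1 / (1 + ln (vh / vl))) \<and>
         nature_law V \<rho> vl vh \<in> distributions V \<and>
         (SUP M\<in>mechanisms V. ereal (relative_revenue M (nature_law V \<rho> vl vh))) =
         (INF F\<in>distributions V. SUP M\<in>mechanisms V. ereal (relative_revenue M F)) \<and>
         (SUP M\<in>mechanisms V. ereal (relative_revenue M (nature_law V \<rho> vl vh))) =
         ereal (1 / (1 + ln (vh / vl)))"
proof -
  interpret robust_bundling \<rho> V vl vh
  proof
    \<comment> \<open>Some \<open>v\<close> in \<open>V\<close> has total \<open>\<xi>\<close>, and
      scaled invariance sends it to this point.\<close>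
    show "\<xi> *\<^sub>R \<rho> \<in> V" if "\<xi> \<in> {vl..vh}" for \<xi>
      using all_totals[OF that] V_inv by (auto simp: scaled_invariant_def)
    show "vl \<le> vh"
      using vl_min(1) vh_max(2) by auto
  qed (use assms in \<open>auto simp: total_value_def\<close>)
  show ?thesis
    using grand_bundling_in_mechanisms grand_bundling_optimal performance_ratio_grand_bundling
      nature_law_in_distributions SUP_relative_revenue_nature_law INF_SUP_relative_revenue
    by simp
qed

end
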